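(* For every positive integer $\Delta$, the number $N(\mathbb{T}^2,\Delta)$ is equal to the maximal number of columns of a generic integer $\Delta$-modular matrix with two rows (of rank two).
   Context: $\mathbb{T}^2=\mathbb{R}^2/\mathbb{Z}^2$ is the torus. For a positive integer $k$, a $k$-system on $\mathbb{T}^2$ is a collection of non-trivial (i.e. not homotopic to a point) simple closed curves on $\mathbb{T}^2$ such that any two of them are non-homotopic and intersect at most $k$ times. Curves are considered up to free homotopy and without orientation. $N(\mathbb{T}^2,k)$ denotes the maximum size of a $k$-system on $\mathbb{T}^2$. An integer matrix $A$ is $\Delta$-modular if the absolute value of the determinant of every full-rank square submatrix (i.e. every $\mathrm{rk}(A)\times \mathrm{rk}(A)$ submatrix) is at most $\Delta$. A matrix $A$ is generic if any $\mathrm{rk}(A)$ of its columns are linearly independent. Thus, for a two-row integer matrix of rank two, generic and $\Delta$-modular means that any two columns are linearly independent and every $2\times 2$ minor has absolute value at most $\Delta$. *)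

theory Defs
  imports "HOL-Analysis.Analysis" "Jordan_Normal_Form.DL_Rank" "Jordan_Normal_Form.DL_Submatrix"
begin

definition int_lattice_rel :: "real \<times> real \<Rightarrow> real \<times> real \<Rightarrow> bool" where
  "int_lattice_rel x y \<longleftrightarrow> fst x - fst y \<in> \<int> \<and> snd x - snd y \<in> \<int>"

lemma equivp_int_lattice_rel: "equivp int_lattice_rel"
proof (rule equivpI)
  show "reflp int_lattice_rel"
    by (auto simp: reflp_def int_lattice_rel_def)
  show "symp int_lattice_rel"
    unfolding symp_def int_lattice_rel_def using Ints_minus by fastforce
  show "transp int_lattice_rel"
    unfolding transp_def int_lattice_rel_def using Ints_add by fastforce
qed

quotient_type torus = "real \<times> real" / int_lattice_rel
  by (rule equivp_int_lattice_rel)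

text \<open>The torus carries the quotient topology of the plane.\<close>

instantiation torus :: topological_space
begin

definition open_torus :: "torus set \<Rightarrow> bool" where
  "open_torus U \<longleftrightarrow> open (abs_torus -` U)"

instance
proof
  show "open (UNIV :: torus set)"
    by (simp add: open_torus_def)
  show "open (S \<inter> T)" if "open S" "open T" for S T :: "torus set"
    using that by (simp add: open_torus_def vimage_Int open_Int)
  show "open (\<Union>K)" if "\<forall>S\<in>K. open S" for K :: "torus set set"
    using that by (auto simp: open_torus_def vimage_Union)
qed

end

text \<open>Closed curves are loops parametrised by the unit interval, and free homotopy is
  \<^const>\<open>homotopic_loops\<close>, which does not fix base points.\<close>

definition simple_closed_curve :: "(real \<Rightarrow> 'a::topological_space) \<Rightarrow> bool" where
  "simple_closed_curve p \<longleftrightarrow> simple_path p \<and> pathfinish p = pathstart p"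

definition nontrivial_loop :: "(real \<Rightarrow> 'a::topological_space) \<Rightarrow> bool" where
  "nontrivial_loop p \<longleftrightarrow> \<not> (\<exists>a. homotopic_loops UNIV p (\<lambda>_. a))"

definition unoriented_homotopic ::
    "(real \<Rightarrow> 'a::topological_space) \<Rightarrow> (real \<Rightarrow> 'a) \<Rightarrow> bool" where
  "unoriented_homotopic p q \<longleftrightarrow>
     homotopic_loops UNIV p q \<or> homotopic_loops UNIV p (reversepath q)"

definition k_system :: "nat \<Rightarrow> (real \<Rightarrow> 'a::topological_space) set \<Rightarrow> bool" where
  "k_system k C \<longleftrightarrow>
     (\<forall>p\<in>C. simple_closed_curve p \<and> nontrivial_loop p) \<and>
     (\<forall>p\<in>C. \<forall>q\<in>C. p \<noteq> q \<longrightarrow>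
        \<not> unoriented_homotopic p q \<and>
        finite (path_image p \<inter> path_image q) \<and>
        card (path_image p \<inter> path_image q) \<le> k)"

text \<open>Finiteness is demanded of every \<open>k\<close>-system because \<^const>\<open>card\<close> is \<open>0\<close> on infinite sets.\<close>

definition is_max_torus_system_size :: "nat \<Rightarrow> nat \<Rightarrow> bool" where
  "is_max_torus_system_size k n \<longleftrightarrow>
     (\<exists>C :: (real \<Rightarrow> torus) set. k_system k C \<and> finite C \<and> card C = n) \<and>
     (\<forall>C :: (real \<Rightarrow> torus) set. k_system k C \<longrightarrow> finite C \<and> card C \<le> n)"

definition N_torus :: "nat \<Rightarrow> nat" where
  "N_torus k = (THE n. is_max_torus_system_size k n)"

abbreviation rat_mat :: "int mat \<Rightarrow> rat mat" where
  "rat_mat A \<equiv> map_mat rat_of_int A"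

definition int_rank :: "int mat \<Rightarrow> nat" where
  "int_rank A = vec_space.rank (dim_row A) (rat_mat A)"

definition Delta_modular :: "nat \<Rightarrow> int mat \<Rightarrow> bool" where
  "Delta_modular \<Delta> A \<longleftrightarrow>
     (\<forall>I J. I \<subseteq> {..<dim_row A} \<and> J \<subseteq> {..<dim_col A} \<and>
        card I = int_rank A \<and> card J = int_rank A \<longrightarrow>
        \<bar>Determinant.det (submatrix A I J)\<bar> \<le> int \<Delta>)"

text \<open>\<open>lin_dep\<close> speaks about sets of vectors; injectivity of the column map on \<open>J\<close> excludes
  repeated columns.\<close>

definition generic :: "int mat \<Rightarrow> bool" where
  "generic A \<longleftrightarrow>
     (\<forall>J \<subseteq> {..<dim_col A}. card J = int_rank A \<longrightarrow>
        inj_on (col (rat_mat A)) J \<and>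
        \<not> LinearCombinations.module.lin_dep class_ring (module_vec TYPE(rat) (dim_row A))
            (col (rat_mat A) ` J))"

definition generic_Delta_modular_two_rows :: "nat \<Rightarrow> int mat \<Rightarrow> bool" where
  "generic_Delta_modular_two_rows \<Delta> A \<longleftrightarrow>
     dim_row A = 2 \<and> int_rank A = 2 \<and> generic A \<and> Delta_modular \<Delta> A"

definition is_max_column_number :: "nat \<Rightarrow> nat \<Rightarrow> bool" where
  "is_max_column_number \<Delta> n \<longleftrightarrow>
     (\<exists>A. generic_Delta_modular_two_rows \<Delta> A \<and> dim_col A = n) \<and>
     (\<forall>A. generic_Delta_modular_two_rows \<Delta> A \<longrightarrow> dim_col A \<le> n)"

definition max_column_number :: "nat \<Rightarrow> nat" where
  "max_column_number \<Delta> = (THE n. is_max_column_number \<Delta> n)"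

end

theory Submission
  imports Defs "HOL-Complex_Analysis.Winding_Numbers"
begin

text \<open>A loop on the torus lifts to a path in the plane whose displacement \<open>v \<in> \<int>\<^sup>2\<close> is a complete
  invariant of free homotopy.  Nontrivial simple closed curves have primitive \<open>v\<close>, and curves of
  classes \<open>v\<close> and \<open>w\<close> meet at least \<open>\<bar>det (v, w)\<bar>\<close> times, with equality for straight curves.  A
  \<open>\<Delta>\<close>-system therefore amounts to a set of primitive vectors, pairwise independent with determinants at most
  \<open>\<Delta>\<close> in absolute value.  Dividing the columns of a generic \<open>\<Delta>\<close>-modular matrix by their contents only
  shrinks the minors, so both maxima are maxima over the same families of vectors.  They exist because
  a vector is determined by its determinants with two independent members of the family.\<close>

section \<open>Integer vectors and determinants in the plane\<close>

definition det2 :: "'a::comm_ring \<times> 'a \<Rightarrow> 'a \<times> 'a \<Rightarrow> 'a" where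
  "det2 v w = fst v * snd w - snd v * fst w"

definition of_ivec :: "int \<times> int \<Rightarrow> real \<times> real" where
  "of_ivec v = (of_int (fst v), of_int (snd v))"

lemma fst_of_ivec [simp]: "fst (of_ivec v) = of_int (fst v)"
  and snd_of_ivec [simp]: "snd (of_ivec v) = of_int (snd v)"
  by (simp_all add: of_ivec_def)

lemma of_ivec_simps [simp]:
  "of_ivec (v + w) = of_ivec v + of_ivec w"
  "of_ivec (- v) = - of_ivec v"
  "of_ivec 0 = 0"
  by (simp_all add: of_ivec_def prod_eq_iff)

lemma of_ivec_eq_iff [simp]: "of_ivec v = of_ivec w \<longleftrightarrow> v = w"
  by (simp add: of_ivec_def prod_eq_iff)

lemma of_ivec_scale: "of_int n *\<^sub>R of_ivec v = of_ivec (n * fst v, n * snd v)"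
  by (simp add: of_ivec_def)

lemma det2_of_ivec: "det2 (of_ivec v) (of_ivec w) = of_int (det2 v w)"
  by (simp add: det2_def)

section \<open>Lifting loops to the plane\<close>

lemma abs_torus_eq_iff: "abs_torus x = abs_torus y \<longleftrightarrow> (\<exists>u. x = y + of_ivec u)"
proof -
  have "int_lattice_rel x y \<longleftrightarrow> (\<exists>u. x = y + of_ivec u)"
  proof
    assume "int_lattice_rel x y"
    then obtain a b where "fst x - fst y = of_int a" "snd x - snd y = of_int b"
      unfolding int_lattice_rel_def by (auto elim!: Ints_cases)
    then have "x = y + of_ivec (a, b)"
      by (simp add: prod_eq_iff algebra_simps)
    then show "\<exists>u. x = y + of_ivec u" ..
  qed (auto simp: int_lattice_rel_def)
  then show ?thesis
    by (simp add: torus.abs_eq_iff)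
qed

lemma abs_torus_surj: "\<exists>x. z = abs_torus x"
  by (metis Quotient_abs_rep Quotient_torus)

lemma continuous_on_abs_torus: "continuous_on S abs_torus"
proof -
  have "continuous_on UNIV abs_torus"
    unfolding continuous_on_open_vimage[OF open_UNIV] by (simp add: open_torus_def)
  then show ?thesis
    by (rule continuous_on_subset) simp
qed

lemma continuous_on_torus:
  assumes "continuous_on UNIV (\<lambda>x. f (abs_torus x))"
  shows "continuous_on UNIV f"
  unfolding continuous_on_open_vimage[OF open_UNIV]
proof safe
  fix B :: "'a set" assume "open B"
  then have "open ((\<lambda>x. f (abs_torus x)) -` B)"
    using assms by (simp add: continuous_on_open_vimage)
  then show "open (f -` B \<inter> UNIV)"
    by (simp add: open_torus_def vimage_def)
qed

text \<open>The character of the torus with frequency \<open>u\<close>. Since \<open>u\<close> is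
  integral, the value does not depend on the representative that \<open>rep_torus\<close>
  picks.\<close>

definition torus_char :: "int \<times> int \<Rightarrow> torus \<Rightarrow> complex" where
  "torus_char u z = exp (of_real (2 * pi * inner (of_ivec u) (rep_torus z)) * \<i>)"

lemma torus_char_abs_torus:
  "torus_char u (abs_torus x) = exp (of_real (2 * pi * inner (of_ivec u) x) * \<i>)"
proof -
  have "abs_torus (rep_torus (abs_torus x)) = abs_torus x"
    by (metis Quotient_abs_rep Quotient_torus)
  then obtain w where w: "rep_torus (abs_torus x) = x + of_ivec w"
    unfolding abs_torus_eq_iff by blast
  define n where "n = fst u * fst w + snd u * snd w"
  have "inner (of_ivec u) (of_ivec w) = of_int n"
    by (simp add: inner_prod_def n_def)
  then show ?thesis
    unfolding torus_char_def w inner_add_right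
    by (auto simp: exp_eq algebra_simps intro!: exI[of _ n])
qed

lemma continuous_on_torus_char: "continuous_on S (torus_char u)"
proof -
  have "continuous_on UNIV (torus_char u)"
    by (rule continuous_on_torus) (auto simp: torus_char_abs_torus intro!: continuous_intros)
  then show ?thesis
    by (rule continuous_on_subset) simp
qed

lemma torus_char_nonzero [simp]: "torus_char u z \<noteq> 0"
  by (simp add: torus_char_def)

definition torus_lift :: "(real \<Rightarrow> torus) \<Rightarrow> (real \<Rightarrow> real \<times> real) \<Rightarrow> bool" where
  "torus_lift p P \<longleftrightarrow> continuous_on {0..1} P \<and> (\<forall>t\<in>{0..1}. p t = abs_torus (P t))"

text \<open>A character never vanishes, so along \<open>p\<close> it has a continuous logarithm on
  the contractible unit interval. The imaginary part divided by \<open>2 * pi\<close> follows the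
  linear form given by \<open>u\<close> along \<open>p\<close>, up to integers.\<close>

lemma torus_char_log:
  assumes "path p"
  obtains g :: "real \<Rightarrow> real" where "continuous_on {0..1} g"
    "\<And>t x. \<lbrakk>t \<in> {0..1}; p t = abs_torus x\<rbrakk> \<Longrightarrow> inner (of_ivec u) x - g t \<in> \<int>"
proof -
  have cont: "continuous_on {0..1} (\<lambda>t. torus_char u (p t))"
    by (rule continuous_on_compose2[OF continuous_on_torus_char[of UNIV]])
       (use assms in \<open>auto simp: path_def\<close>)
  have "contractible {0..1::real}"
    by (simp add: convex_imp_contractible)
  from continuous_logarithm_on_contractible[OF cont this]
  obtain h where h: "continuous_on {0..1} h" "\<And>t. t \<in> {0..1} \<Longrightarrow> torus_char u (p t) = exp (h t)"
    by auto
  show thesis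
  proof
    show "continuous_on {0..1} (\<lambda>t. Im (h t) / (2 * pi))"
      by (intro continuous_intros h) auto
    fix t x assume t: "t \<in> {0..1}" and x: "p t = abs_torus x"
    have "exp (of_real (2 * pi * inner (of_ivec u) x) * \<i>) = exp (h t)"
      using h(2)[OF t] by (simp add: x torus_char_abs_torus)
    then obtain n :: int where "of_real (2 * pi * inner (of_ivec u) x) * \<i> = h t + of_int (2 * n) * pi * \<i>"
      unfolding exp_eq by blast
    then have "Im (of_real (2 * pi * inner (of_ivec u) x) * \<i>) = Im (h t + of_int (2 * n) * pi * \<i>)"
      by (rule arg_cong)
    then have "2 * pi * inner (of_ivec u) x = Im (h t) + 2 * of_int n * pi"
      by simp
    then have "inner (of_ivec u) x - Im (h t) / (2 * pi) = of_int n"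
      by (simp add: field_simps)
    then show "inner (of_ivec u) x - Im (h t) / (2 * pi) \<in> \<int>"
      by simp
  qed
qed

lemma torus_lift_exists:
  assumes "path p"
  obtains P where "torus_lift p P"
proof -
  \<comment> \<open>The frequencies \<open>(1, 0)\<close> and \<open>(0, 1)\<close> provide the two
    coordinates of the lift.\<close>
  obtain g where g: "continuous_on {0..1} g"
    "\<And>t x. \<lbrakk>t \<in> {0..1}; p t = abs_torus x\<rbrakk> \<Longrightarrow> inner (of_ivec (1, 0)) x - g t \<in> \<int>"
    using torus_char_log[OF assms] by metis
  obtain h where h: "continuous_on {0..1} h"
    "\<And>t x. \<lbrakk>t \<in> {0..1}; p t = abs_torus x\<rbrakk> \<Longrightarrow> inner (of_ivec (0, 1)) x - h t \<in> \<int>"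
    using torus_char_log[OF assms] by metis
  have "torus_lift p (\<lambda>t. (g t, h t))"
    unfolding torus_lift_def
  proof safe
    show "continuous_on {0..1} (\<lambda>t. (g t, h t))"
      by (intro continuous_intros g h)
    fix t :: real assume t: "t \<in> {0..1}"
    obtain x where x: "p t = abs_torus x"
      using abs_torus_surj by blast
    have "int_lattice_rel x (g t, h t)"
      using g(2)[OF t x] h(2)[OF t x] by (simp add: int_lattice_rel_def inner_prod_def)
    then show "p t = abs_torus (g t, h t)"
      by (simp add: x torus.abs_eq_iff)
  qed
  then show thesis ..
qed

section \<open>Displacement classes and free homotopy\<close>

definition has_class :: "(real \<Rightarrow> torus) \<Rightarrow> int \<times> int \<Rightarrow> bool" where
  "has_class p v \<longleftrightarrow> (\<exists>P. torus_lift p P \<and> P 1 = P 0 + of_ivec v)"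

lemma has_class_exists:
  assumes "path p" "pathfinish p = pathstart p"
  obtains v where "has_class p v"
proof -
  obtain P where P: "torus_lift p P"
    using torus_lift_exists[OF assms(1)] .
  have "abs_torus (P 1) = abs_torus (P 0)"
    using P assms(2) by (simp add: torus_lift_def pathfinish_def pathstart_def)
  then show thesis
    using P that unfolding abs_torus_eq_iff has_class_def by blast
qed

lemma has_class_reversepath:
  assumes "has_class p v"
  shows "has_class (reversepath p) (- v)"
proof -
  obtain P where P: "torus_lift p P" "P 1 = P 0 + of_ivec v"
    using assms unfolding has_class_def by blast
  have "continuous_on {0..1} (\<lambda>t. P (1 - t))"
    by (rule continuous_on_compose2[of "{0..1}" P])
       (use P in \<open>auto simp: torus_lift_def intro!: continuous_intros\<close>)
  then have "torus_lift (reversepath p) (\<lambda>t. P (1 - t))"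
    using P by (auto simp: torus_lift_def reversepath_def)
  then show ?thesis
    unfolding has_class_def using P by (intro exI conjI) auto
qed

lemma has_class_const: "has_class (\<lambda>_. a) 0"
proof -
  obtain x where "a = abs_torus x"
    using abs_torus_surj by blast
  then have "torus_lift (\<lambda>_. a) (\<lambda>_. x)"
    by (simp add: torus_lift_def)
  then show ?thesis
    unfolding has_class_def by (intro exI conjI) auto
qed

text \<open>The straight-line homotopy between two lifts works: every intermediate lift again has
  displacement \<open>v\<close>, so it projects to a closed loop.\<close>

lemma has_class_imp_homotopic:
  assumes "has_class p v" "has_class q v"
  shows "homotopic_loops UNIV p q"
proof -
  obtain P where P: "continuous_on {0..1} P" "\<And>t. t \<in> {0..1} \<Longrightarrow> p t = abs_torus (P t)"
    "P 1 = P 0 + of_ivec v"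
    using assms(1) unfolding has_class_def torus_lift_def by blast
  obtain Q where Q: "continuous_on {0..1} Q" "\<And>t. t \<in> {0..1} \<Longrightarrow> q t = abs_torus (Q t)"
    "Q 1 = Q 0 + of_ivec v"
    using assms(2) unfolding has_class_def torus_lift_def by blast
  define H where "H z = (1 - fst z) *\<^sub>R P (snd z) + fst z *\<^sub>R Q (snd z)" for z :: "real \<times> real"
  have "continuous_on ({0..1} \<times> {0..1}) H"
    unfolding H_def
    by (intro continuous_intros continuous_on_compose2[OF P(1)] continuous_on_compose2[OF Q(1)]) auto
  then have "continuous_on ({0..1} \<times> {0..1}) (\<lambda>z. abs_torus (H z))"
    by (rule continuous_on_compose2[OF continuous_on_abs_torus[of UNIV]]) simp
  moreover have "abs_torus (H (s, 1)) = abs_torus (H (s, 0))" for s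
    unfolding abs_torus_eq_iff
    by (intro exI[of _ v]) (simp add: H_def P Q algebra_simps)
  ultimately show ?thesis
    unfolding homotopic_loops
    by (intro exI[of _ "\<lambda>z. abs_torus (H z)"])
       (auto simp: H_def P(2) Q(2) pathfinish_def pathstart_def)
qed

text \<open>A lift of \<open>p\<close> yields an explicit logarithm of the character along
  \<open>p\<close>, whose increment is \<open>2 * pi * \<i>\<close> times the pairing of
  \<open>u\<close> with \<open>v\<close>.\<close>

lemma winding_number_torus_char:
  assumes "has_class p v"
  shows "winding_number (torus_char u \<circ> p) 0 = of_int (fst u * fst v + snd u * snd v)"
proof -
  obtain P where P: "continuous_on {0..1} P" "\<And>t. t \<in> {0..1} \<Longrightarrow> p t = abs_torus (P t)"
    "P 1 = P 0 + of_ivec v"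
    using assms unfolding has_class_def torus_lift_def by blast
  define g where "g t = of_real (2 * pi * inner (of_ivec u) (P t)) * \<i>" for t
  have "path g"
    unfolding path_def g_def by (intro continuous_intros P)
  have "winding_number (torus_char u \<circ> p) 0 = winding_number (exp \<circ> g) 0"
    by (rule winding_number_cong) (simp add: P(2) torus_char_abs_torus g_def)
  also have "\<dots> = (pathfinish g - pathstart g) / (2 * of_real pi * \<i>)"
    by (rule winding_number_compose_exp[OF \<open>path g\<close>])
  also have "\<dots> = of_real (inner (of_ivec u) (of_ivec v))"
    by (simp add: g_def pathfinish_def pathstart_def P(3) inner_add_right field_simps)
  also have "\<dots> = of_int (fst u * fst v + snd u * snd v)"
    by (simp add: inner_prod_def)
  finally show ?thesis .
qed

text \<open>Characters map the torus into the punctured plane, where winding numbers are invariant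
  under homotopy; the frequencies \<open>(1, 0)\<close> and \<open>(0, 1)\<close> then recover the
  coordinates of the class. With equal loops this also shows that a loop has only one class.\<close>

lemma homotopic_imp_same_class:
  assumes "homotopic_loops UNIV p q" "has_class p v" "has_class q w"
  shows "v = w"
proof -
  have "homotopic_loops (- {0}) (torus_char u \<circ> p) (torus_char u \<circ> q)" for u
    by (rule homotopic_loops_continuous_image[OF assms(1) continuous_on_torus_char]) auto
  from winding_number_homotopic_loops[OF this]
  have "fst u * fst v + snd u * snd v = fst u * fst w + snd u * snd w" for u
    unfolding winding_number_torus_char[OF assms(2)] winding_number_torus_char[OF assms(3)]
      of_int_eq_iff .
  from this[of "(1, 0)"] this[of "(0, 1)"] show ?thesis
    by (simp add: prod_eq_iff)
qed

lemma nontrivial_loop_iff: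
  assumes "has_class p v"
  shows "nontrivial_loop p \<longleftrightarrow> v \<noteq> 0"
  unfolding nontrivial_loop_def
  using has_class_imp_homotopic has_class_const homotopic_imp_same_class assms by metis

lemma unoriented_homotopic_iff:
  assumes "has_class p v" "has_class q w"
  shows "unoriented_homotopic p q \<longleftrightarrow> v = w \<or> v = - w"
  unfolding unoriented_homotopic_def
  using has_class_imp_homotopic has_class_reversepath homotopic_imp_same_class assms by metis

section \<open>Simple closed curves represent primitive classes\<close>

lemma simple_closed_curve_primitive:
  assumes p: "simple_closed_curve p" and cls: "has_class p v" and "v \<noteq> 0"
  shows "coprime (fst v) (snd v)"
proof -
  obtain P where P: "continuous_on {0..1} P" "\<And>t. t \<in> {0..1} \<Longrightarrow> p t = abs_torus (P t)"
    "P 1 = P 0 + of_ivec v"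
    using cls unfolding has_class_def torus_lift_def by blast
  define g where "g = gcd (fst v) (snd v)"
  have "g > 0"
    using \<open>v \<noteq> 0\<close> by (auto simp: g_def prod_eq_iff)
  define a b where "a = fst v div g" and "b = snd v div g"
  have v: "fst v = g * a" "snd v = g * b"
    by (simp_all add: a_def b_def g_def)
  have "coprime a b"
    using \<open>g > 0\<close> by (auto simp: a_def b_def g_def intro: div_gcd_coprime)
  then obtain x y where "x * a + y * b = 1"
    by (metis bezout_int coprime_iff_gcd_eq_1)
  then have xy: "of_int x * of_int a + of_int y * of_int b = (1::real)"
    by (metis of_int_1 of_int_add of_int_mult)
  text \<open>The linear isomorphism \<open>l\<close> sends the primitive vector \<open>(a, b)\<close> to \<open>1\<close>, so that
    \<open>exp (2 \<pi> i l)\<close> identifies the annulus covering of the torus belonging to \<open>(a, b)\<close> with the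
    punctured plane.  There \<open>p\<close> stays simple and winds \<open>g\<close> times around \<open>0\<close>.\<close>
  define l :: "real \<times> real \<Rightarrow> complex" where
    "l z = Complex (of_int x * fst z + of_int y * snd z) (of_int a * snd z - of_int b * fst z)"
    for z :: "real \<times> real"
  define h where "h t = 2 * of_real pi * \<i> * l (P t)" for t
  have l_diff: "l z - l z' = l (z - z')" for z z'
    by (simp add: l_def complex_eq_iff algebra_simps)
  have l_v: "l (of_ivec v) = of_int g"
  proof -
    have "l (of_ivec v) = Complex (g * (x * a + y * b)) 0"
      by (simp add: l_def v algebra_simps)
    then show ?thesis
      by (simp add: xy complex_eq_iff)
  qed
  \<comment> \<open>The Bezout relation inverts \<open>l\<close>: a difference with
    \<open>l\<close>-value \<open>n\<close> is \<open>n\<close> times \<open>(a, b)\<close>, hence a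
    lattice vector.\<close>
  have l_inj: "\<exists>u. z = z' + of_ivec u" if "l z = l z' + of_int n" for z z' n
  proof -
    have *: "x * fst (z - z') + y * snd (z - z') = n" "a * snd (z - z') = b * fst (z - z')"
      using that l_diff[of z z'] by (auto simp: l_def complex_eq_iff)
    have "fst (z - z') = (x * a + y * b) * fst (z - z')"
      by (simp add: xy)
    also have "\<dots> = a * (x * fst (z - z')) + y * (b * fst (z - z'))"
      by (simp add: algebra_simps)
    also have "\<dots> = a * (x * fst (z - z') + y * snd (z - z'))"
      by (simp only: *(2)[symmetric]) (simp add: algebra_simps)
    finally have 1: "fst (z - z') = of_int (a * n)"
      by (simp only: *(1) of_int_mult)
    have "snd (z - z') = (x * a + y * b) * snd (z - z')"
      by (simp add: xy)
    also have "\<dots> = b * (y * snd (z - z')) + x * (a * snd (z - z'))"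
      by (simp add: algebra_simps)
    also have "\<dots> = b * (x * fst (z - z') + y * snd (z - z'))"
      by (simp only: *(2)) (simp add: algebra_simps)
    finally have 2: "snd (z - z') = of_int (b * n)"
      by (simp only: *(1) of_int_mult)
    have "z = z' + of_ivec (a * n, b * n)"
      using 1 2 by (simp add: prod_eq_iff algebra_simps)
    then show ?thesis ..
  qed
  have "path h"
    unfolding path_def h_def l_def Complex_eq by (intro continuous_intros P)
  have hfs: "pathfinish h - pathstart h = 2 * of_real pi * \<i> * of_int g"
    by (simp add: h_def pathfinish_def pathstart_def P(3) l_v[symmetric] flip: right_diff_distrib)
       (simp add: l_diff)
  have "simple_path (exp \<circ> h)"
    unfolding simple_path_def loop_free_def
  proof (intro conjI ballI impI)
    show "path (exp \<circ> h)"
      using \<open>path h\<close> by (auto simp: path_def o_def intro: continuous_intros)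
    fix s t :: real assume st: "s \<in> {0..1}" "t \<in> {0..1}" and "(exp \<circ> h) s = (exp \<circ> h) t"
    then obtain n where "h s = h t + of_int (2 * n) * of_real pi * \<i>"
      by (auto simp: exp_eq)
    then have "2 * of_real pi * \<i> * l (P s) = 2 * of_real pi * \<i> * (l (P t) + of_int n)"
      by (simp add: h_def algebra_simps)
    then have "l (P s) = l (P t) + of_int n"
      by simp
    then have "p s = p t"
      unfolding P(2)[OF st(1)] P(2)[OF st(2)] abs_torus_eq_iff by (rule l_inj)
    then show "s = t \<or> s = 0 \<and> t = 1 \<or> s = 1 \<and> t = 0"
      using p st by (simp add: simple_closed_curve_def simple_path_def loop_free_def)
  qed
  moreover have "pathfinish (exp \<circ> h) = pathstart (exp \<circ> h)"
    using hfs unfolding pathfinish_def pathstart_def o_def exp_eq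
    by (intro exI[of _ g]) (simp add: algebra_simps)
  moreover have "0 \<notin> path_image (exp \<circ> h)"
    by (auto simp: path_image_def)
  \<comment> \<open>A simple closed curve winds -1, 0 or 1 times around a point off it, whereas the
    logarithm \<open>h\<close> gives \<open>g > 0\<close> turns.\<close>
  ultimately have "winding_number (exp \<circ> h) 0 \<in> {-1, 0, 1}"
    by (rule simple_closed_path_winding_number_cases)
  moreover have "winding_number (exp \<circ> h) 0 = of_int g"
    using winding_number_compose_exp[OF \<open>path h\<close>] hfs by simp
  ultimately have "(of_int g :: complex) \<in> {of_int (-1), of_int 0, of_int 1}"
    by simp
  then have "g = 1"
    using \<open>g > 0\<close> by (auto simp del: of_int_minus of_int_0 of_int_1)
  then show ?thesis
    by (simp add: g_def coprime_iff_gcd_eq_1)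
qed

section \<open>Lower bound for the number of intersections\<close>

text \<open>On every unit interval the periodic extension is a translate of \<open>a\<close>, and
  \<open>a01\<close> makes neighbouring pieces agree where they meet.\<close>

lemma continuous_on_frac_compose:
  fixes a :: "real \<Rightarrow> 'a::topological_space"
  assumes a: "continuous_on {0..1} a" and a01: "a 0 = a 1"
  shows "continuous_on UNIV (\<lambda>t. a (frac t))"
proof -
  have piece: "continuous_on {of_int n..of_int n + 1} (\<lambda>t. a (frac t))" for n :: int
  proof -
    have "continuous_on {of_int n..of_int n + 1} (\<lambda>t. a (t - of_int n))"
      by (rule continuous_on_compose2[OF a]) (auto intro!: continuous_intros)
    moreover have "a (t - of_int n) = a (frac t)" if "t \<in> {of_int n..of_int n + 1}" for t
    proof (cases "t = of_int n + 1")
      case False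
      then have "frac t = t - of_int n"
        using that by (subst frac_unique_iff) auto
      then show ?thesis by simp
    qed (simp add: a01)
    ultimately show ?thesis
      by (rule continuous_on_eq)
  qed
  show ?thesis
  proof (intro continuous_at_imp_continuous_on ballI)
    fix t :: real
    define n where "n = \<lfloor>t\<rfloor>"
    \<comment> \<open>As \<open>t\<close> may equal \<open>n\<close>, the piece to the left of
      \<open>n\<close> is glued on to obtain a neighbourhood of \<open>t\<close>.\<close>
    have "continuous_on ({of_int (n - 1)..of_int (n - 1) + 1} \<union> {of_int n..of_int n + 1}) (\<lambda>t. a (frac t))"
      by (intro continuous_on_closed_Un piece) auto
    then have "continuous_on {of_int n - 1<..<of_int n + 1} (\<lambda>t. a (frac t))"
      by (rule continuous_on_subset) auto
    moreover have "t \<in> {of_int n - 1<..<of_int n + 1}"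
      unfolding n_def by auto linarith+
    ultimately show "isCont (\<lambda>t. a (frac t)) t"
      by (simp add: continuous_on_eq_continuous_at)
  qed
qed

text \<open>Continued to the whole line, the lift differs from the straight motion
  \<open>s *\<^sub>R of_ivec v\<close> by a periodic, hence bounded, term \<open>A\<close>. The last
  property encodes the simplicity of \<open>p\<close>.\<close>

lemma simple_closed_curve_periodic_lift:
  assumes p: "simple_closed_curve p" and cls: "has_class p v"
  obtains A :: "real \<Rightarrow> real \<times> real" where
    "continuous_on UNIV A" "bounded (range A)"
    "\<And>s. abs_torus (s *\<^sub>R of_ivec v + A s) \<in> path_image p"
    "\<And>s t. abs_torus (s *\<^sub>R of_ivec v + A s) = abs_torus (t *\<^sub>R of_ivec v + A t)
       \<Longrightarrow> s - t \<in> \<int> \<and> A s = A t"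
proof -
  obtain P where P: "continuous_on {0..1} P" "\<And>t. t \<in> {0..1} \<Longrightarrow> p t = abs_torus (P t)"
    "P 1 = P 0 + of_ivec v"
    using cls unfolding has_class_def torus_lift_def by blast
  define a where "a t = P t - t *\<^sub>R of_ivec v" for t
  define A where "A t = a (frac t)" for t
  have frac01: "frac t \<in> {0..1}" for t :: real
    using frac_ge_0[of t] frac_lt_1[of t] by simp
  have a: "continuous_on {0..1} a"
    unfolding a_def by (intro continuous_intros P)
  have lift: "abs_torus (s *\<^sub>R of_ivec v + A s) = p (frac s)" for s
  proof -
    have "s *\<^sub>R of_ivec v + A s = P (frac s) + of_int \<lfloor>s\<rfloor> *\<^sub>R of_ivec v"
      unfolding A_def a_def frac_def by (simp add: algebra_simps)
    then show ?thesis
      unfolding P(2)[OF frac01] abs_torus_eq_iff of_ivec_scale by blast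
  qed
  show thesis
  proof
    show "continuous_on UNIV A"
      unfolding A_def by (intro continuous_on_frac_compose a) (simp add: a_def P(3))
    have "bounded (a ` {0..1})"
      by (intro compact_imp_bounded compact_continuous_image a) simp
    then show "bounded (range A)"
      by (rule bounded_subset) (use frac01 in \<open>auto simp: A_def\<close>)
    show "abs_torus (s *\<^sub>R of_ivec v + A s) \<in> path_image p" for s
      using frac01 by (simp add: lift path_image_def)
    fix s t
    assume "abs_torus (s *\<^sub>R of_ivec v + A s) = abs_torus (t *\<^sub>R of_ivec v + A t)"
    then have "p (frac s) = p (frac t)"
      by (simp only: lift)
    \<comment> \<open>Fractional parts are below 1, so the endpoint cases of
      \<open>loop_free\<close> drop out.\<close>
    then have "frac s = frac t"
      using p frac01[of s] frac01[of t] frac_lt_1[of s] frac_lt_1[of t]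
      unfolding simple_closed_curve_def simple_path_def loop_free_def by fastforce
    moreover have "s - t = of_int (\<lfloor>s\<rfloor> - \<lfloor>t\<rfloor>) + (frac s - frac t)"
      by (simp add: frac_def)
    ultimately show "s - t \<in> \<int> \<and> A s = A t"
      by (simp add: A_def)
  qed
qed

text \<open>A bounded perturbation cannot destroy the crossing of two transversal lines: the
  crossing parameters are a fixed point of a continuous map with bounded range, which Brouwer's
  theorem supplies.\<close>

lemma transversal_curves_meet:
  fixes v w u :: "real \<times> real"
  assumes D: "det2 v w \<noteq> 0"
    and A: "continuous_on UNIV A" "bounded (range A)"
    and B: "continuous_on UNIV B" "bounded (range B)"
  obtains s t :: real where "s *\<^sub>R v + A s + u = t *\<^sub>R w + B t"
proof -
  define Z where "Z x = B (snd x) - A (fst x) - u" for x :: "real \<times> real"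
  \<comment> \<open>Cramer's rule: \<open>G z\<close> is the pair \<open>(s, t)\<close> that solves
    \<open>s v - t w = z\<close>, so a fixed point of \<open>G\<close> after \<open>Z\<close> is a
    crossing.\<close>
  define G where "G z = (det2 z w / det2 v w, det2 z v / det2 v w)" for z
  have contG: "continuous_on S G" for S
    unfolding G_def det2_def using D by (auto simp: det2_def intro!: continuous_intros)
  have contZ: "continuous_on S Z" for S
    unfolding Z_def
    by (intro continuous_intros continuous_on_compose2[OF A(1)] continuous_on_compose2[OF B(1)]) auto
  have "bounded (range (B \<circ> snd))" "bounded (range (A \<circ> fst))"
    unfolding image_comp[symmetric] using A(2) B(2) by (auto intro: bounded_subset)
  then have "bounded (range Z)"
    unfolding Z_def o_def by (intro bounded_minus_comp) (simp_all add: o_def)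
  then have "bounded (G ` closure (range Z))"
    by (intro compact_imp_bounded compact_continuous_image contG) simp
  then obtain r where "r > 0" and "\<forall>x\<in>G ` closure (range Z). norm x \<le> r"
    unfolding bounded_pos by blast
  then have r: "norm (G (Z x)) \<le> r" for x
    by (meson closure_subset imageI rangeI subsetD)
  obtain x where x: "G (Z x) = x"
  proof (rule brouwer[of "cball 0 r" "\<lambda>x. G (Z x)"])
    show "continuous_on (cball 0 r) (\<lambda>x. G (Z x))"
      by (rule continuous_on_compose2[OF contG contZ]) (rule subset_UNIV)
  qed (use \<open>r > 0\<close> r in auto)
  have "fst x * det2 v w = det2 (Z x) w" "snd x * det2 v w = det2 (Z x) v"
    using arg_cong[OF x, of fst] arg_cong[OF x, of snd] D by (simp_all add: G_def field_simps)
  then have "det2 v w *\<^sub>R (fst x *\<^sub>R v - snd x *\<^sub>R w) = det2 (Z x) w *\<^sub>R v - det2 (Z x) v *\<^sub>R w"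
    by (simp add: scaleR_diff_right mult.commute)
  also have "\<dots> = det2 v w *\<^sub>R Z x"
    by (simp add: det2_def prod_eq_iff algebra_simps)
  finally have "fst x *\<^sub>R v - snd x *\<^sub>R w = Z x"
    using D by simp
  then have "fst x *\<^sub>R v + A (fst x) + u = snd x *\<^sub>R w + B (snd x)"
    by (simp add: Z_def algebra_simps)
  then show thesis
    by (rule that)
qed

text \<open>The lifts of \<open>p\<close> translated by \<open>i *\<^sub>R x\<close>, where \<open>det2 v x = 1\<close>, each meet one fixed
  lift of \<open>q\<close>.  The resulting points of the torus differ because the \<open>\<bar>det2 v w\<bar>\<close> vectors
  \<open>i *\<^sub>R x\<close> are incongruent modulo the lattice spanned by \<open>v\<close> and \<open>w\<close>.\<close>

lemma abs_det2_le_card_intersection: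
  assumes p: "simple_closed_curve p" "has_class p v"
    and q: "simple_closed_curve q" "has_class q w"
    and v: "coprime (fst v) (snd v)"
    and fin: "finite (path_image p \<inter> path_image q)"
  shows "nat \<bar>det2 v w\<bar> \<le> card (path_image p \<inter> path_image q)"
proof (cases "det2 v w = 0")
  case False
  obtain A where A: "continuous_on UNIV A" "bounded (range A)"
    "\<And>s. abs_torus (s *\<^sub>R of_ivec v + A s) \<in> path_image p"
    "\<And>s t. abs_torus (s *\<^sub>R of_ivec v + A s) = abs_torus (t *\<^sub>R of_ivec v + A t)
       \<Longrightarrow> s - t \<in> \<int> \<and> A s = A t"
    by (rule simple_closed_curve_periodic_lift[OF p]) blast
  obtain B where B: "continuous_on UNIV B" "bounded (range B)"
    "\<And>s. abs_torus (s *\<^sub>R of_ivec w + B s) \<in> path_image q"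
    "\<And>s t. abs_torus (s *\<^sub>R of_ivec w + B s) = abs_torus (t *\<^sub>R of_ivec w + B t)
       \<Longrightarrow> s - t \<in> \<int> \<and> B s = B t"
    by (rule simple_closed_curve_periodic_lift[OF q]) blast
  \<comment> \<open>The vector \<open>(- x, y)\<close> has determinant 1 with \<open>v\<close>;
    \<open>U i\<close> will be its multiple by \<open>i\<close>.\<close>
  obtain x y where "y * fst v + x * snd v = 1"
    using v by (metis bezout_int coprime_iff_gcd_eq_1)
  then have u: "det2 v (- (i * x), i * y) = i" for i
    by (simp add: det2_def) (metis distrib_left mult.assoc mult.commute mult.right_neutral)
  define U where "U i = of_ivec (- (i * x), i * y)" for i
  have "\<exists>s t. s *\<^sub>R of_ivec v + A s + U i = t *\<^sub>R of_ivec w + B t" for i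
    using transversal_curves_meet[OF _ A(1,2) B(1,2), of "of_ivec v" "of_ivec w" "U i"] False
    by (metis det2_of_ivec of_int_eq_0_iff)
  then obtain s t where st: "s i *\<^sub>R of_ivec v + A (s i) + U i = t i *\<^sub>R of_ivec w + B (t i)" for i
    by metis
  define X where "X i = abs_torus (t i *\<^sub>R of_ivec w + B (t i))" for i
  \<comment> \<open>\<open>U i\<close> is a lattice vector, so \<open>X i\<close> lies on
    \<open>p\<close> as well as on \<open>q\<close>.\<close>
  have X: "X i = abs_torus (s i *\<^sub>R of_ivec v + A (s i))" for i
    unfolding X_def st[symmetric] abs_torus_eq_iff U_def by blast
  have "inj_on X {0..<\<bar>det2 v w\<bar>}"
  proof
    fix i j assume ij: "i \<in> {0..<\<bar>det2 v w\<bar>}" "j \<in> {0..<\<bar>det2 v w\<bar>}" and eq: "X i = X j"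
    obtain m where m: "s i - s j = of_int m" "A (s i) = A (s j)"
      using A(4) eq unfolding X by (metis Ints_cases)
    obtain n where n: "t i - t j = of_int n" "B (t i) = B (t j)"
      using B(4) eq unfolding X_def by (metis Ints_cases)
    have U: "U i = (t i *\<^sub>R of_ivec w + B (t i)) - (s i *\<^sub>R of_ivec v + A (s i))" for i
      using st[of i] by (metis add_diff_cancel_left')
    have "U i - U j = (t i - t j) *\<^sub>R of_ivec w - (s i - s j) *\<^sub>R of_ivec v"
      unfolding U m(2) n(2) by (simp add: algebra_simps)
    then have *: "U i - U j = of_int n *\<^sub>R of_ivec w - of_int m *\<^sub>R of_ivec v"
      by (simp only: m n)
    \<comment> \<open>The determinant with \<open>v\<close> kills the \<open>v\<close> term and
      turns the congruence into divisibility of \<open>i - j\<close> by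
      \<open>det2 v w\<close>.\<close>
    have "real_of_int (i - j) = det2 (of_ivec v) (U i) - det2 (of_ivec v) (U j)"
      by (simp add: U_def det2_of_ivec u)
    also have "\<dots> = det2 (of_ivec v) (U i - U j)"
      by (simp add: det2_def algebra_simps)
    also have "\<dots> = of_int n * det2 (of_ivec v) (of_ivec w)"
      unfolding * by (simp add: det2_def algebra_simps)
    finally have "i - j = n * det2 v w"
      unfolding det2_of_ivec by (simp only: of_int_eq_iff flip: of_int_mult)
    then have "det2 v w dvd i - j"
      by simp
    moreover have "\<bar>i - j\<bar> < \<bar>det2 v w\<bar>"
      using ij by auto
    ultimately show "i = j"
      using dvd_imp_le_int[of "i - j" "det2 v w"] by force
  qed
  moreover have "X ` {0..<\<bar>det2 v w\<bar>} \<subseteq> path_image p \<inter> path_image q"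
  proof -
    have "X i \<in> path_image p" "X i \<in> path_image q" for i
      using A(3)[of "s i"] B(3)[of "t i"] by (simp_all only: X[symmetric] X_def[symmetric])
    then show ?thesis
      by blast
  qed
  ultimately have "card {0..<\<bar>det2 v w\<bar>} \<le> card (path_image p \<inter> path_image q)"
    by (rule card_inj_on_le[OF _ _ fin])
  then show ?thesis
    by simp
qed simp

section \<open>Straight curves\<close>

definition straight_curve :: "int \<times> int \<Rightarrow> real \<Rightarrow> torus" where
  "straight_curve v t = abs_torus (t *\<^sub>R of_ivec v)"

lemma has_class_straight_curve: "has_class (straight_curve v) v"
  unfolding has_class_def torus_lift_def straight_curve_def
  by (intro exI[of _ "\<lambda>t. t *\<^sub>R of_ivec v"]) (auto intro!: continuous_intros)

text \<open>By Bezout an integral linear form takes the value 1 at \<open>v\<close>. Evaluated at a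
  lattice vector \<open>(s - t) v\<close>, it shows that \<open>s - t\<close> is an integer.\<close>

lemma simple_closed_straight_curve:
  assumes "coprime (fst v) (snd v)"
  shows "simple_closed_curve (straight_curve v)"
proof -
  obtain x y where "x * fst v + y * snd v = 1"
    using assms by (metis bezout_int coprime_iff_gcd_eq_1)
  then have xy: "of_int x * of_int (fst v) + of_int y * of_int (snd v) = (1::real)"
    by (metis of_int_1 of_int_add of_int_mult)
  have "continuous_on {0..1} (\<lambda>t::real. abs_torus (t *\<^sub>R of_ivec v))"
    by (rule continuous_on_compose2[OF continuous_on_abs_torus[of UNIV]]) (auto intro!: continuous_intros)
  then have "path (straight_curve v)"
    by (simp add: path_def straight_curve_def)
  moreover have "loop_free (straight_curve v)"
    unfolding loop_free_def
  proof (intro ballI impI)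
    fix s t :: real assume st: "s \<in> {0..1}" "t \<in> {0..1}" and eq: "straight_curve v s = straight_curve v t"
    then obtain u where "s *\<^sub>R of_ivec v = t *\<^sub>R of_ivec v + of_ivec u"
      by (auto simp: straight_curve_def abs_torus_eq_iff)
    then have u: "(s - t) * of_int (fst v) = of_int (fst u)" "(s - t) * of_int (snd v) = of_int (snd u)"
      by (auto simp: prod_eq_iff algebra_simps)
    have "s - t = (s - t) * (of_int x * of_int (fst v) + of_int y * of_int (snd v))"
      by (simp add: xy)
    also have "\<dots> = of_int x * ((s - t) * of_int (fst v)) + of_int y * ((s - t) * of_int (snd v))"
      by (simp add: algebra_simps)
    also have "\<dots> = of_int (x * fst u + y * snd u)"
      by (simp only: u of_int_add of_int_mult)
    finally obtain n where n: "s - t = of_int n" ..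
    then have "n \<in> {-1, 0, 1}"
      using st by auto
    then show "s = t \<or> s = 0 \<and> t = 1 \<or> s = 1 \<and> t = 0"
      using st n by auto
  qed
  moreover have "pathfinish (straight_curve v) = pathstart (straight_curve v)"
    by (auto simp: pathfinish_def pathstart_def straight_curve_def abs_torus_eq_iff)
  ultimately show ?thesis
    by (simp add: simple_closed_curve_def simple_path_def)
qed

text \<open>At a common point, taking the determinant with \<open>w\<close> eliminates the parameter
  along \<open>w\<close>, so the parameter \<open>t\<close> along \<open>v\<close> makes
  \<open>t * d\<close> an integer. Modulo 1 this leaves the \<open>\<bar>d\<bar>\<close> values
  \<open>j / d\<close>.\<close>

lemma straight_curve_intersection:
  assumes "det2 v w \<noteq> 0"
  shows "finite (path_image (straight_curve v) \<inter> path_image (straight_curve w))"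
    and "card (path_image (straight_curve v) \<inter> path_image (straight_curve w)) \<le> nat \<bar>det2 v w\<bar>"
proof -
  define d where "d = det2 v w"
  define f where "f j = straight_curve v (of_int j / of_int d)" for j
  have sub: "path_image (straight_curve v) \<inter> path_image (straight_curve w) \<subseteq> f ` {0..<\<bar>d\<bar>}"
  proof
    fix z assume "z \<in> path_image (straight_curve v) \<inter> path_image (straight_curve w)"
    then obtain t s where t: "z = straight_curve v t" and s: "z = straight_curve w s"
      unfolding path_image_def by blast
    then have "abs_torus (t *\<^sub>R of_ivec v) = abs_torus (s *\<^sub>R of_ivec w)"
      by (simp add: straight_curve_def)
    then obtain u where u: "t *\<^sub>R of_ivec v = s *\<^sub>R of_ivec w + of_ivec u"
      unfolding abs_torus_eq_iff by blast
    define m where "m = det2 u w"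
    have "t * of_int d = det2 (t *\<^sub>R of_ivec v) (of_ivec w)"
      by (simp add: d_def det2_def algebra_simps)
    also have "\<dots> = of_int m"
      unfolding u by (simp add: m_def det2_def algebra_simps)
    finally have "t = of_int m / of_int d"
      using assms by (simp add: d_def field_simps)
    \<comment> \<open>Division is by \<open>\<bar>d\<bar>\<close> so that the remainder lies in
      \<open>{0..<\<bar>d\<bar>}\<close>; the factor \<open>sgn d\<close> absorbs the sign of
      \<open>d\<close>.\<close>
    define k where "k = sgn d * (m div \<bar>d\<bar>)"
    have "m = m mod \<bar>d\<bar> + d * k"
      unfolding k_def using div_mult_mod_eq[of m "\<bar>d\<bar>"]
      by (metis ab_semigroup_mult_class.mult_ac(1) abs_sgn add.commute mult.commute)
    then have "of_int m = of_int (m mod \<bar>d\<bar>) + of_int d * (of_int k :: real)"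
      by (metis of_int_add of_int_mult)
    then have "t = of_int (m mod \<bar>d\<bar>) / of_int d + of_int k"
      using assms \<open>t = _\<close> by (simp add: d_def field_simps)
    then have "z = f (m mod \<bar>d\<bar>)"
      unfolding t f_def straight_curve_def abs_torus_eq_iff
      by (intro exI[of _ "(k * fst v, k * snd v)"]) (simp add: scaleR_add_left of_ivec_scale)
    then show "z \<in> f ` {0..<\<bar>d\<bar>}"
      using assms by (simp add: d_def)
  qed
  show "finite (path_image (straight_curve v) \<inter> path_image (straight_curve w))"
    by (rule finite_subset[OF sub]) simp
  show "card (path_image (straight_curve v) \<inter> path_image (straight_curve w)) \<le> nat \<bar>det2 v w\<bar>"
    using surj_card_le[OF _ sub] by (simp add: d_def)
qed

section \<open>Families of integer vectors with bounded determinants\<close>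

definition bounded_family :: "nat \<Rightarrow> (int \<times> int) set \<Rightarrow> bool" where
  "bounded_family k V \<longleftrightarrow>
     (\<forall>v\<in>V. \<forall>w\<in>V. v \<noteq> w \<longrightarrow> det2 v w \<noteq> 0 \<and> \<bar>det2 v w\<bar> \<le> int k)"

lemma bounded_family_subset: "\<lbrakk>bounded_family k V; W \<subseteq> V\<rbrakk> \<Longrightarrow> bounded_family k W"
  unfolding bounded_family_def by blast

text \<open>For two distinct members \<open>v\<close> and \<open>w\<close>, Cramer's rule recovers
  any \<open>u\<close> from \<open>det2 u v\<close> and \<open>det2 u w\<close>, and each of these
  takes at most \<open>2 * k + 1\<close> values. This covers \<open>v\<close> and \<open>w\<close>
  too, whose determinants with themselves are 0.\<close>

lemma card_bounded_family:
  assumes fam: "bounded_family k V" and "finite V"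
  shows "card V \<le> (2 * k + 1)\<^sup>2"
proof (cases "card V \<le> 1")
  case True
  then show ?thesis
    by (rule order_trans) simp
next
  case False
  then obtain v w where vw: "v \<in> V" "w \<in> V" "v \<noteq> w"
    by (metis card_le_Suc0_iff_eq One_nat_def \<open>finite V\<close>)
  let ?f = "\<lambda>u. (det2 u v, det2 u w)"
  let ?I = "{- int k..int k}"
  have "inj_on ?f V"
  proof
    fix x y assume "?f x = ?f y"
    then have "det2 x v = det2 y v" "det2 x w = det2 y w"
      by simp_all
    moreover have "det2 v w * fst u = fst v * det2 u w - fst w * det2 u v"
      "det2 v w * snd u = snd v * det2 u w - snd w * det2 u v" for u
      by (simp_all add: det2_def algebra_simps)
    ultimately have "det2 v w * fst x = det2 v w * fst y" "det2 v w * snd x = det2 v w * snd y"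
      by simp_all
    moreover have "det2 v w \<noteq> 0"
      using fam vw by (simp add: bounded_family_def)
    ultimately show "x = y"
      by (simp add: prod_eq_iff)
  qed
  moreover have "?f ` V \<subseteq> ?I \<times> ?I"
  proof -
    have "\<bar>det2 u x\<bar> \<le> int k" if "u \<in> V" "x \<in> V" for u x
      using fam that by (cases "u = x") (auto simp: bounded_family_def det2_def)
    then show ?thesis
      using vw by (fastforce simp: abs_le_iff)
  qed
  ultimately have "card V \<le> card (?I \<times> ?I)"
    by (rule card_inj_on_le) simp
  then show ?thesis
    by (simp add: card_cartesian_product power2_eq_square nat_add_distrib nat_mult_distrib)
qed

text \<open>Up to signs, the coordinates form equal fractions in lowest terms, so they agree in
  absolute value; the original equation then makes the signs consistent.\<close>

lemma coprime_det2_eq_0: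
  assumes "coprime (fst v) (snd v)" "coprime (fst w) (snd w)" and "det2 v w = (0::int)"
  shows "v = w \<or> v = - w"
proof -
  have *: "fst v * snd w = fst w * snd v"
    using assms(3) by (simp add: det2_def)
  then have "\<bar>fst v\<bar> * \<bar>snd w\<bar> = \<bar>fst w\<bar> * \<bar>snd v\<bar>"
    by (metis abs_mult)
  then have "\<bar>fst v\<bar> = \<bar>fst w\<bar>" "\<bar>snd v\<bar> = \<bar>snd w\<bar>"
    by (simp_all add: coprime_crossproduct_int[OF assms(1,2)])
  then show ?thesis
    using * by (auto simp: prod_eq_iff abs_eq_iff)
qed

section \<open>Systems of curves and bounded families\<close>

text \<open>The map \<open>f\<close> assigns to each curve its class. Primitive classes that differ
  even up to sign are independent, and the lower bound on intersections limits their determinants by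
  \<open>k\<close>.\<close>

lemma k_system_imp_bounded_family:
  assumes "k_system k C"
  obtains f :: "(real \<Rightarrow> torus) \<Rightarrow> int \<times> int" where "inj_on f C" "bounded_family k (f ` C)"
proof -
  have C: "simple_closed_curve p" "nontrivial_loop p" if "p \<in> C" for p
    using assms that by (auto simp: k_system_def)
  have "\<exists>v. has_class p v" if "p \<in> C" for p
    using C(1)[OF that] has_class_exists unfolding simple_closed_curve_def simple_path_def by blast
  then obtain f where f: "\<And>p. p \<in> C \<Longrightarrow> has_class p (f p)"
    by metis
  have cop: "coprime (fst (f p)) (snd (f p))" if "p \<in> C" for p
    using simple_closed_curve_primitive[OF C(1) f] nontrivial_loop_iff[OF f] C(2) that by blast
  have distinct: "f p \<noteq> f q \<and> f p \<noteq> - f q" if "p \<in> C" "q \<in> C" "p \<noteq> q" for p q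
    using assms that unoriented_homotopic_iff[OF f f] by (simp add: k_system_def)
  have "det2 (f p) (f q) \<noteq> 0 \<and> \<bar>det2 (f p) (f q)\<bar> \<le> int k" if pq: "p \<in> C" "q \<in> C" "p \<noteq> q" for p q
  proof
    show "det2 (f p) (f q) \<noteq> 0"
      using coprime_det2_eq_0 cop distinct pq by blast
    have "finite (path_image p \<inter> path_image q)" "card (path_image p \<inter> path_image q) \<le> k"
      using assms pq by (auto simp: k_system_def)
    then show "\<bar>det2 (f p) (f q)\<bar> \<le> int k"
      using abs_det2_le_card_intersection[OF C(1) f C(1) f cop] pq by fastforce
  qed
  then have "bounded_family k (f ` C)"
    unfolding bounded_family_def by blast
  moreover have "inj_on f C"
    using distinct by (auto simp: inj_on_def)
  ultimately show thesis
    using that by blast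
qed

section \<open>Primitive vectors and systems of straight curves\<close>

definition primitive_vec :: "int \<times> int \<Rightarrow> int \<times> int" where
  "primitive_vec v = (fst v div gcd (fst v) (snd v), snd v div gcd (fst v) (snd v))"

lemma coprime_primitive_vec:
  "v \<noteq> 0 \<Longrightarrow> coprime (fst (primitive_vec v)) (snd (primitive_vec v))"
  by (auto simp: primitive_vec_def prod_eq_iff intro: div_gcd_coprime)

lemma det2_primitive_vec:
  "det2 v w = gcd (fst v) (snd v) * gcd (fst w) (snd w) * det2 (primitive_vec v) (primitive_vec w)"
proof -
  define g h where "g = gcd (fst v) (snd v)" and "h = gcd (fst w) (snd w)"
  let ?v = "primitive_vec v" and ?w = "primitive_vec w"
  have "fst v = g * fst ?v" "snd v = g * snd ?v" "fst w = h * fst ?w" "snd w = h * snd ?w"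
    by (simp_all add: primitive_vec_def g_def h_def)
  then have "det2 v w = (g * fst ?v) * (h * snd ?w) - (g * snd ?v) * (h * fst ?w)"
    by (simp add: det2_def)
  then show ?thesis
    unfolding g_def[symmetric] h_def[symmetric] by (simp add: det2_def algebra_simps)
qed

text \<open>Straight curves in the primitive directions serve as the system. Dividing vectors by
  their contents keeps determinants nonzero and does not increase their absolute values.\<close>

lemma bounded_family_imp_k_system:
  assumes fam: "bounded_family k V" and "finite V" and V0: "0 \<notin> V"
  obtains C :: "(real \<Rightarrow> torus) set" where "k_system k C" "finite C" "card C = card V"
proof -
  define f where "f v = straight_curve (primitive_vec v)" for v
  have cop: "coprime (fst (primitive_vec v)) (snd (primitive_vec v))" if "v \<in> V" for v
    using coprime_primitive_vec V0 that by metis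
  have det: "det2 (primitive_vec v) (primitive_vec w) \<noteq> 0 \<and>
      \<bar>det2 (primitive_vec v) (primitive_vec w)\<bar> \<le> int k"
    if vw: "v \<in> V" "w \<in> V" "v \<noteq> w" for v w
  proof -
    let ?g = "gcd (fst v) (snd v) * gcd (fst w) (snd w)"
    let ?d = "det2 (primitive_vec v) (primitive_vec w)"
    have "v \<noteq> 0" "w \<noteq> 0"
      using V0 vw by auto
    then have "gcd (fst v) (snd v) > 0" "gcd (fst w) (snd w) > 0"
      by (auto simp: prod_eq_iff)
    then have "?g > 0"
      by (rule mult_pos_pos)
    then have "?g \<ge> 1"
      by linarith
    have "\<bar>?d\<bar> \<le> ?g * \<bar>?d\<bar>"
      using mult_right_mono[OF \<open>?g \<ge> 1\<close>, of "\<bar>?d\<bar>"] by simp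
    also have "\<dots> = \<bar>det2 v w\<bar>"
      unfolding det2_primitive_vec[of v w] using \<open>?g > 0\<close> by (simp add: abs_mult)
    finally have "\<bar>?d\<bar> \<le> \<bar>det2 v w\<bar>" .
    moreover have "det2 v w \<noteq> 0" "\<bar>det2 v w\<bar> \<le> int k"
      using fam vw by (auto simp: bounded_family_def)
    ultimately show ?thesis
      using det2_primitive_vec[of v w] by auto
  qed
  have not_hom: "\<not> unoriented_homotopic (f v) (f w)" if vw: "v \<in> V" "w \<in> V" "v \<noteq> w" for v w
    unfolding f_def unoriented_homotopic_iff[OF has_class_straight_curve has_class_straight_curve]
    using det[OF vw] by (auto simp: det2_def)
  have hom_refl: "unoriented_homotopic (f v) (f v)" for v
    unfolding f_def unoriented_homotopic_iff[OF has_class_straight_curve has_class_straight_curve] by simp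
  have "k_system k (f ` V)"
    unfolding k_system_def
  proof (intro conjI ballI impI)
    fix p assume "p \<in> f ` V"
    then obtain v where v: "v \<in> V" "p = f v" by blast
    then show "simple_closed_curve p"
      using simple_closed_straight_curve cop by (simp add: f_def)
    have "primitive_vec v \<noteq> 0"
      using cop[OF v(1)] by auto
    then show "nontrivial_loop p"
      unfolding v f_def nontrivial_loop_iff[OF has_class_straight_curve] .
  next
    fix p q assume "p \<in> f ` V" "q \<in> f ` V" "p \<noteq> q"
    then obtain v w where vw: "v \<in> V" "w \<in> V" "v \<noteq> w" and pq: "p = f v" "q = f w" by blast
    show "\<not> unoriented_homotopic p q"
      unfolding pq by (rule not_hom[OF vw])
    show "finite (path_image p \<inter> path_image q)"
      unfolding pq f_def using det[OF vw] straight_curve_intersection(1) by blast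
    show "card (path_image p \<inter> path_image q) \<le> k"
      unfolding pq f_def using det[OF vw] straight_curve_intersection(2) by fastforce
  qed
  \<comment> \<open>Equal curves would be homotopic by \<open>hom_refl\<close>, so
    \<open>not_hom\<close> separates the images.\<close>
  moreover have "inj_on f V"
    using not_hom hom_refl by (metis inj_onI)
  ultimately show thesis
    using that \<open>finite V\<close> by (simp add: card_image)
qed

section \<open>Matrices and bounded families\<close>

lemma det_2x2:
  assumes "A \<in> carrier_mat 2 2"
  shows "Determinant.det A = A $$ (0, 0) * A $$ (1, 1) - A $$ (0, 1) * A $$ (1, 0)"
proof -
  have "Determinant.det A = (\<Sum>j<2. A $$ (0, j) * cofactor A 0 j)"
    by (rule laplace_expansion_row[OF assms]) simp
  also have "\<dots> = A $$ (0, 0) * cofactor A 0 0 + A $$ (0, 1) * cofactor A 0 1"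
    by (simp add: numeral_2_eq_2)
  also have "cofactor A 0 0 = A $$ (1, 1)"
    using assms by (simp add: cofactor_def det_single mat_delete_def)
  also have "cofactor A 0 1 = - A $$ (1, 0)"
    using assms by (simp add: cofactor_def det_single mat_delete_def)
  finally show ?thesis
    by simp
qed

definition matrix_column :: "int mat \<Rightarrow> nat \<Rightarrow> int \<times> int" where
  "matrix_column A j = (A $$ (0, j), A $$ (1, j))"

text \<open>\<open>submatrix\<close> keeps the selected columns in increasing order, so
  \<open>i < j\<close> fixes the sign of the minor. Counting the smaller selected indices shows that
  \<open>i\<close> and \<open>j\<close> become columns 0 and 1.\<close>

lemma det_submatrix_2:
  assumes "dim_row A = 2" "i < j" "j < dim_col A"
  shows "Determinant.det (submatrix A {..<2} {i, j}) = det2 (matrix_column A i) (matrix_column A j)"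
proof -
  let ?B = "submatrix A {..<2} {i, j}"
  have "{k. k < dim_row A \<and> k \<in> {..<2}} = {..<2}" "{k. k < dim_col A \<and> k \<in> {i, j}} = {i, j}"
    using assms by auto
  then have "?B \<in> carrier_mat 2 2"
    using assms by (intro carrier_matI) (simp_all add: dim_submatrix)
  have row: "card {a \<in> {..<2}. a < r} = r" if "r < 2" for r :: nat
  proof -
    have "{a \<in> {..<2}. a < r} = {..<r}" using that by auto
    then show ?thesis by simp
  qed
  have "{a \<in> {i, j}. a < i} = {}" "{a \<in> {i, j}. a < j} = {i}"
    using assms by auto
  then have col: "card {a \<in> {i, j}. a < i} = 0" "card {a \<in> {i, j}. a < j} = 1"
    by (simp_all only: card.empty card_1_singleton_iff) simp
  have "?B $$ (r, 0) = A $$ (r, i)" "?B $$ (r, 1) = A $$ (r, j)" if "r < 2" for r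
    using submatrix_index_card[of r A i "{..<2}" "{i, j}"] submatrix_index_card[of r A j "{..<2}" "{i, j}"]
      assms that unfolding row[OF that] col by simp_all
  then show ?thesis
    unfolding det_2x2[OF \<open>?B \<in> carrier_mat 2 2\<close>] by (simp add: matrix_column_def det2_def)
qed

text \<open>For the square matrix \<open>B\<close> with these two columns, a nonzero determinant
  means full rank, which means that the columns are distinct and independent; \<open>inj_on\<close>
  expresses the distinctness.\<close>

lemma independent_columns_iff:
  assumes A: "dim_row A = 2" and ij: "i < dim_col A" "j < dim_col A" "i \<noteq> j"
  shows "inj_on (col (rat_mat A)) {i, j} \<and>
      \<not> LinearCombinations.module.lin_dep class_ring (module_vec TYPE(rat) 2) (col (rat_mat A) ` {i, j})
    \<longleftrightarrow> det2 (matrix_column A i) (matrix_column A j) \<noteq> 0"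
proof -
  interpret vec_space "TYPE(rat)" 2 .
  let ?c = "col (rat_mat A)"
  define B where "B = mat_of_cols 2 [?c i, ?c j]"
  have B: "B \<in> carrier_mat 2 2"
    using mat_of_cols_carrier(1)[of 2 "[?c i, ?c j]"] by (simp add: B_def numeral_2_eq_2)
  have "?c k \<in> carrier_vec 2" for k
    using A by (intro carrier_vecI) simp
  then have cols: "cols B = [?c i, ?c j]"
    unfolding B_def by (intro cols_mat_of_cols) auto
  have "Determinant.det B = of_int (det2 (matrix_column A i) (matrix_column A j))"
    unfolding det_2x2[OF B] using A ij
    by (simp add: B_def mat_of_cols_def matrix_column_def det2_def)
  moreover have "Determinant.det B \<noteq> 0 \<longleftrightarrow> distinct (cols B) \<and> lin_indpt (set (cols B))"
    by (metis det_rank_iff[OF B] lin_indpt_full_rank[OF B] full_rank_lin_indpt[OF B]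
      non_distinct_low_rank[OF B] less_irrefl)
  ultimately show ?thesis
    using ij(3) by (auto simp: cols)
qed

text \<open>The rank is the size of a maximal independent set of columns, and these live in a space
  of dimension \<open>n\<close>.\<close>

lemma (in vec_space) rank_le_dim_row:
  assumes "A \<in> carrier_mat n nc"
  shows "rank A \<le> n"
proof -
  obtain S where S: "maximal S (\<lambda>T. T \<subseteq> set (cols A) \<and> lin_indpt T)"
    using maximal_exists_superset[of "set (cols A)" "\<lambda>T. T \<subseteq> set (cols A) \<and> lin_indpt T" "{}"]
    by (auto simp: lin_dep_def)
  then have "S \<subseteq> set (cols A)" "lin_indpt S"
    by (auto simp: maximal_def)
  moreover have "set (cols A) \<subseteq> carrier_vec n"
    using assms cols_dim by blast
  ultimately have "card S \<le> dim"
    by (intro li_le_dim) auto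
  then show ?thesis
    using rank_card_indpt[OF assms S] dim_is_n by simp
qed

lemma generic_matrix_imp_bounded_family:
  assumes "generic_Delta_modular_two_rows k A"
  obtains V where "finite V" "card V = dim_col A" "bounded_family k V"
proof -
  have A: "dim_row A = 2" "int_rank A = 2" "generic A" "Delta_modular k A"
    using assms by (auto simp: generic_Delta_modular_two_rows_def)
  let ?c = "matrix_column A"
  have det: "det2 (?c i) (?c j) \<noteq> 0 \<and> \<bar>det2 (?c i) (?c j)\<bar> \<le> int k"
    if ij: "i < j" "j < dim_col A" for i j
  proof
    have J: "{i, j} \<subseteq> {..<dim_col A}" "card {i, j} = int_rank A"
      using ij by (simp_all add: A)
    then have "inj_on (col (rat_mat A)) {i, j} \<and>
      \<not> LinearCombinations.module.lin_dep class_ring (module_vec TYPE(rat) 2) (col (rat_mat A) ` {i, j})"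
      using A(3) unfolding generic_def A(1) by blast
    then show "det2 (?c i) (?c j) \<noteq> 0"
      using independent_columns_iff[OF A(1), of i j] ij by auto
    have "\<bar>Determinant.det (submatrix A {..<2} {i, j})\<bar> \<le> int k"
      using A(4) J unfolding Delta_modular_def by (auto simp: A(1,2))
    then show "\<bar>det2 (?c i) (?c j)\<bar> \<le> int k"
      using det_submatrix_2[OF A(1) ij] by simp
  qed
  \<comment> \<open>The minors only cover pairs with \<open>i < j\<close>; antisymmetry extends the
    bounds to all pairs of distinct indices.\<close>
  have det2_swap: "det2 v w = - det2 w v" for v w :: "int \<times> int"
    by (simp add: det2_def)
  have det': "det2 (?c i) (?c j) \<noteq> 0 \<and> \<bar>det2 (?c i) (?c j)\<bar> \<le> int k"
    if "i \<noteq> j" "i < dim_col A" "j < dim_col A" for i j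
    using that det[of i j] det[of j i] det2_swap[of "?c i" "?c j"] by (cases "i < j") auto
  have "inj_on ?c {..<dim_col A}"
  proof
    fix i j assume "i \<in> {..<dim_col A}" "j \<in> {..<dim_col A}" "?c i = ?c j"
    then show "i = j"
      using det'[of i j] by (auto simp: det2_def)
  qed
  moreover have "bounded_family k (?c ` {..<dim_col A})"
    unfolding bounded_family_def
  proof (intro ballI impI)
    fix v w assume "v \<in> ?c ` {..<dim_col A}" "w \<in> ?c ` {..<dim_col A}" "v \<noteq> w"
    then obtain i j where ij: "i < dim_col A" "j < dim_col A" "v = ?c i" "w = ?c j"
      by blast
    with \<open>v \<noteq> w\<close> have "i \<noteq> j"
      by blast
    from det'[OF this ij(1,2)] show "det2 v w \<noteq> 0 \<and> \<bar>det2 v w\<bar> \<le> int k"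
      unfolding ij(3,4) .
  qed
  ultimately show thesis
    using that[of "?c ` {..<dim_col A}"] by (simp add: card_image)
qed

text \<open>The members of \<open>V\<close>, in any order, become the columns. The first two exist
  by \<open>2 \<le> card V\<close> and already force rank two, so genericity and the bound on minors
  reduce to pairs of columns.\<close>

lemma bounded_family_imp_generic_matrix:
  assumes fam: "bounded_family k V" and "finite V" "2 \<le> card V"
  obtains A where "generic_Delta_modular_two_rows k A" "dim_col A = card V"
proof -
  obtain vs where vs: "set vs = V" "distinct vs"
    using finite_distinct_list[OF \<open>finite V\<close>] by blast
  then have len: "length vs = card V"
    by (metis distinct_card)
  define A where "A = mat 2 (card V) (\<lambda>(r, j). if r = 0 then fst (vs ! j) else snd (vs ! j))"
  have dims: "dim_row A = 2" "dim_col A = card V"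
    by (simp_all add: A_def)
  have col: "matrix_column A j = vs ! j" if "j < card V" for j
    using that by (simp add: matrix_column_def A_def)
  have det: "det2 (matrix_column A i) (matrix_column A j) \<noteq> 0 \<and>
      \<bar>det2 (matrix_column A i) (matrix_column A j)\<bar> \<le> int k"
    if "i < card V" "j < card V" "i \<noteq> j" for i j
    using fam that vs len by (auto simp: col bounded_family_def nth_eq_iff_index_eq)
  \<comment> \<open>Index pairs are put in increasing order to suit
    \<open>det_submatrix_2\<close>.\<close>
  have pair: "\<exists>i j. J = {i, j} \<and> i < j \<and> j < card V" if "J \<subseteq> {..<card V}" "card J = 2" for J
  proof -
    obtain i j where "J = {i, j}" "i \<noteq> j"
      using \<open>card J = 2\<close> unfolding card_2_iff by blast
    then have "J = {min i j, max i j} \<and> min i j < max i j \<and> max i j < card V"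
      using that(1) by (auto simp: min_def max_def)
    then show ?thesis
      by blast
  qed
  have rank: "int_rank A = 2"
  proof -
    interpret vec_space "TYPE(rat)" 2 .
    let ?c = "col (rat_mat A)"
    have carrier: "rat_mat A \<in> carrier_mat 2 (card V)"
      using dims by (intro carrier_matI) simp_all
    have ind: "inj_on ?c {0, 1} \<and> lin_indpt (?c ` {0, 1})"
      using independent_columns_iff[OF dims(1), of 0 1] det[of 0 1] \<open>2 \<le> card V\<close> by (simp add: dims)
    moreover have "?c ` {0, 1} \<subseteq> set (cols (rat_mat A))"
      using \<open>2 \<le> card V\<close> by (auto simp: cols_def dims)
    ultimately have "card (?c ` {0, 1}) \<le> rank (rat_mat A)"
      by (intro rank_ge_card_indpt[OF carrier]) auto
    moreover have "card (?c ` {0, 1}) = card {0, 1::nat}"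
      using ind by (intro card_image) auto
    ultimately show ?thesis
      using rank_le_dim_row[OF carrier] by (simp add: int_rank_def dims)
  qed
  have "generic A"
    unfolding generic_def rank dims
  proof (intro allI impI)
    fix J :: "nat set" assume "J \<subseteq> {..<card V}" "card J = 2"
    from pair[OF this] obtain i j where ij: "J = {i, j}" "i < j" "j < card V" by blast
    then show "inj_on (col (rat_mat A)) J \<and>
      \<not> LinearCombinations.module.lin_dep class_ring (module_vec TYPE(rat) 2) (col (rat_mat A) ` J)"
      using independent_columns_iff[OF dims(1), of i j] det[of i j] by (simp add: dims)
  qed
  moreover have "Delta_modular k A"
    unfolding Delta_modular_def rank dims
  proof (intro allI impI)
    fix I J :: "nat set" assume IJ: "I \<subseteq> {..<2} \<and> J \<subseteq> {..<card V} \<and> card I = 2 \<and> card J = 2"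
    then obtain i j where ij: "J = {i, j}" "i < j" "j < card V"
      using pair by blast
    moreover have "I = {..<2}"
      using IJ by (intro card_subset_eq) auto
    ultimately show "\<bar>Determinant.det (submatrix A I J)\<bar> \<le> int k"
      using det_submatrix_2[OF dims(1), of i j] det[of i j] by (simp add: dims)
  qed
  ultimately have "generic_Delta_modular_two_rows k A"
    unfolding generic_Delta_modular_two_rows_def using dims(1) rank by blast
  then show thesis
    using dims(2) that by blast
qed

section \<open>Equality of the two maxima\<close>

text \<open>The family \<open>{0}\<close> is bounded vacuously, but a second member would have
  determinant 0 with the zero vector.\<close>

lemma bounded_family_zero_notin:
  assumes "bounded_family k V" "2 \<le> card V"
  shows "0 \<notin> V"
proof
  assume "0 \<in> V"
  have "V \<noteq> {0}"
    using assms(2) by auto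
  then obtain v where "v \<in> V" "v \<noteq> 0"
    using \<open>0 \<in> V\<close> by blast
  then have "det2 v 0 \<noteq> 0"
    using assms(1) \<open>0 \<in> V\<close> unfolding bounded_family_def by blast
  then show False
    by (simp add: det2_def)
qed

text \<open>Both maxima are compared with the largest size of a finite bounded family, which exists
  by \<open>card_bounded_family\<close>.\<close>

lemma max_sizes_coincide:
  assumes "\<Delta> \<ge> 1"
  obtains m where "is_max_torus_system_size \<Delta> m" "is_max_column_number \<Delta> m"
proof -
  define S where "S = {card V | V. finite V \<and> bounded_family \<Delta> V}"
  have "S \<subseteq> {..(2 * \<Delta> + 1)\<^sup>2}"
    using card_bounded_family by (auto simp: S_def)
  then have fin: "finite S"
    by (rule finite_subset) simp
  \<comment> \<open>The unit vectors have determinant 1, so \<open>\<Delta> \<ge> 1\<close> puts 2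
    into \<open>S\<close>. The resulting \<open>2 \<le> m\<close> keeps 0 out of an optimal family
    and gives its matrix rank two.\<close>
  have "bounded_family \<Delta> {(1, 0), (0, 1)}"
    using assms by (auto simp: bounded_family_def det2_def)
  moreover have "card {(1, 0), (0, 1) :: int \<times> int} = 2"
    by simp
  ultimately have "2 \<in> S"
    unfolding S_def by (intro CollectI exI conjI) auto
  define m where "m = Max S"
  have "m \<in> S"
    unfolding m_def using fin \<open>2 \<in> S\<close> by (intro Max_in) auto
  then obtain V where V: "finite V" "bounded_family \<Delta> V" "card V = m"
    by (auto simp: S_def)
  have "2 \<le> m"
    unfolding m_def using fin \<open>2 \<in> S\<close> by (rule Max_ge)
  have le_m: "card W \<le> m" if "finite W" "bounded_family \<Delta> W" for W
    unfolding m_def using fin that by (intro Max_ge) (auto simp: S_def)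
  have "is_max_torus_system_size \<Delta> m"
    unfolding is_max_torus_system_size_def
  proof (intro conjI allI impI)
    show "\<exists>C :: (real \<Rightarrow> torus) set. k_system \<Delta> C \<and> finite C \<and> card C = m"
      using bounded_family_imp_k_system[OF V(2,1)] bounded_family_zero_notin[OF V(2)] V(3) \<open>2 \<le> m\<close>
      by metis
  next
    fix C :: "(real \<Rightarrow> torus) set" assume "k_system \<Delta> C"
    then obtain f where f: "inj_on f C" "bounded_family \<Delta> (f ` C)"
      using k_system_imp_bounded_family by blast
    \<comment> \<open>An infinite family would contain a finite one with \<open>m + 1\<close>
      members, against the maximality of \<open>m\<close>.\<close>
    have "finite (f ` C)"
    proof (rule ccontr)
      assume "infinite (f ` C)"
      then obtain W where "finite W" "card W = Suc m" "W \<subseteq> f ` C"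
        using infinite_arbitrarily_large by blast
      then show False
        using le_m[of W] bounded_family_subset[OF f(2)] by simp
    qed
    then show "finite C"
      using f(1) finite_image_iff by blast
    show "card C \<le> m"
      using le_m[OF \<open>finite (f ` C)\<close> f(2)] card_image[OF f(1)] by simp
  qed
  moreover have "is_max_column_number \<Delta> m"
    unfolding is_max_column_number_def
  proof (intro conjI allI impI)
    show "\<exists>A. generic_Delta_modular_two_rows \<Delta> A \<and> dim_col A = m"
      using bounded_family_imp_generic_matrix[OF V(2,1)] V(3) \<open>2 \<le> m\<close> by metis
    show "dim_col A \<le> m" if "generic_Delta_modular_two_rows \<Delta> A" for A
      using generic_matrix_imp_bounded_family[OF that] le_m by metis
  qed
  ultimately show thesis
    by (rule that)
qed

text \<open>Asserting that both maxima are attained keeps the equality from comparing unspecified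
  values of \<open>THE\<close>.\<close>

theorem mainTheorem2:
  fixes \<Delta> :: nat
  assumes "\<Delta> \<ge> 1"
  shows "is_max_torus_system_size \<Delta> (N_torus \<Delta>)
    \<and> is_max_column_number \<Delta> (max_column_number \<Delta>)
    \<and> N_torus \<Delta> = max_column_number \<Delta>"
proof -
  obtain m where m: "is_max_torus_system_size \<Delta> m" "is_max_column_number \<Delta> m"
    using max_sizes_coincide[OF assms] .
  \<comment> \<open>Two maxima bound each other, so the definite description denotes
    \<open>m\<close>.\<close>
  have "N_torus \<Delta> = m"
    unfolding N_torus_def
    using m(1) by (intro the_equality) (auto simp: is_max_torus_system_size_def intro: antisym)
  moreover have "max_column_number \<Delta> = m"
    unfolding max_column_number_def
    using m(2) by (intro the_equality) (auto simp: is_max_column_number_def intro: antisym)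
  ultimately show ?thesis
    using m by simp
qed

end
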